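(* Let $M$ be a disconnected binary matroid without loops and without coloops, and let $x, y$ be distinct elements of $E(M)$ such that $x$ and $y$ are not in a $2$-cocircuit of $M$ (that is, $\{x,y\}$ is not a cocircuit of $M$). Then the splitting matroid $M_{x,y}$ is connected if and only if $M$ has exactly two (connected) components, each of which contains either $x$ or $y$ (that is, one component contains $x$ and the other contains $y$).
   Context: Splitting operation: let $M$ be a binary matroid on a finite set $E = E(M)$ and let $A$ be a matrix over $GF(2)$ representing $M$, with columns labelled by the elements of $E$. For distinct elements $x, y \in E$, let $A_{x,y}$ be the matrix obtained from $A$ by adjoining one extra row which is zero everywhere except in the columns corresponding to $x$ and $y$, where it takes the value $1$. The splitting matroid $M_{x,y}$ is the vector matroid (over $GF(2)$, on the same ground set $E$) of the matrix $A_{x,y}$; it depends only on $M$, $x$, $y$ and not on the choice of $A$. A matroid is connected if every two distinct elements of its ground set lie in a common circuit, and disconnected otherwise; its components are the equivalence classes of the relation "$e = f$ or $e$ and $f$ lie in a common circuit". *)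

theory Defs
  imports Complex_Main "HOL-Library.Z2" "HOL-Library.Function_Algebras"
begin

section \<open>Matroids\<close>

record 'e pre_matroid =
  ground :: "'e set"
  indep :: "'e set \<Rightarrow> bool"

definition matroid :: "'e pre_matroid \<Rightarrow> bool" where
  "matroid M \<longleftrightarrow>
     finite (ground M) \<and>
     (\<forall>X. indep M X \<longrightarrow> X \<subseteq> ground M) \<and>
     indep M {} \<and>
     (\<forall>X Y. indep M X \<and> Y \<subseteq> X \<longrightarrow> indep M Y) \<and>
     (\<forall>X Y. indep M X \<and> indep M Y \<and> card X < card Y \<longrightarrow>
        (\<exists>e \<in> Y - X. indep M (insert e X)))"

definition basis :: "'e pre_matroid \<Rightarrow> 'e set \<Rightarrow> bool" where
  "basis M B \<longleftrightarrow> indep M B \<and> (\<forall>X. indep M X \<and> B \<subseteq> X \<longrightarrow> X = B)"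

definition circuit :: "'e pre_matroid \<Rightarrow> 'e set \<Rightarrow> bool" where
  "circuit M C \<longleftrightarrow> C \<subseteq> ground M \<and> \<not> indep M C \<and> (\<forall>X. X \<subset> C \<longrightarrow> indep M X)"

text \<open>A set is independent in the dual iff it is contained in the complement of a basis.\<close>

definition dual :: "'e pre_matroid \<Rightarrow> 'e pre_matroid" where
  "dual M = \<lparr>ground = ground M,
             indep = (\<lambda>X. X \<subseteq> ground M \<and> (\<exists>B. basis M B \<and> X \<inter> B = {}))\<rparr>"

definition cocircuit :: "'e pre_matroid \<Rightarrow> 'e set \<Rightarrow> bool" where
  "cocircuit M C \<longleftrightarrow> circuit (dual M) C"

definition loop :: "'e pre_matroid \<Rightarrow> 'e \<Rightarrow> bool" where
  "loop M e \<longleftrightarrow> circuit M {e}"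

definition coloop :: "'e pre_matroid \<Rightarrow> 'e \<Rightarrow> bool" where
  "coloop M e \<longleftrightarrow> loop (dual M) e"

definition matroid_connected :: "'e pre_matroid \<Rightarrow> bool" where
  "matroid_connected M \<longleftrightarrow>
     (\<forall>e \<in> ground M. \<forall>f \<in> ground M. e \<noteq> f \<longrightarrow> (\<exists>C. circuit M C \<and> e \<in> C \<and> f \<in> C))"

definition component_rel :: "'e pre_matroid \<Rightarrow> ('e \<times> 'e) set" where
  "component_rel M =
     {(e, f). e \<in> ground M \<and> f \<in> ground M \<and>
              (e = f \<or> (\<exists>C. circuit M C \<and> e \<in> C \<and> f \<in> C))}"

definition components :: "'e pre_matroid \<Rightarrow> 'e set set" where
  "components M = ground M // component_rel M"


section \<open>Binary matroids and splitting\<close>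

text \<open>
  A matrix over GF(2) with columns labelled by elements of \<^typ>\<open>'e\<close> is the list of its rows.
  Entries in columns outside the ground set under consideration are irrelevant. Columns are
  vectors in \<^typ>\<open>nat \<Rightarrow> bit\<close>, padded with zeros below the last row.
\<close>

type_synonym 'e gf2_matrix = "('e \<Rightarrow> bit) list"

definition column :: "'e gf2_matrix \<Rightarrow> 'e \<Rightarrow> nat \<Rightarrow> bit" where
  "column A e = (\<lambda>i. if i < length A then (A ! i) e else 0)"

interpretation gf2: vector_space "\<lambda>(c::bit) (v::nat \<Rightarrow> bit) i. c * v i"
  by unfold_locales (auto simp: fun_eq_iff algebra_simps)

text \<open>
  Linear independence is that of the family of columns indexed by \<open>X\<close>, so two equal columns
  with different labels are dependent; hence the injectivity condition.
\<close>

definition vector_matroid :: "'e set \<Rightarrow> 'e gf2_matrix \<Rightarrow> 'e pre_matroid" where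
  "vector_matroid E A =
     \<lparr>ground = E,
      indep = (\<lambda>X. X \<subseteq> E \<and> inj_on (column A) X \<and> gf2.independent (column A ` X))\<rparr>"

definition represents :: "'e gf2_matrix \<Rightarrow> 'e pre_matroid \<Rightarrow> bool" where
  "represents A M \<longleftrightarrow> vector_matroid (ground M) A = M"

definition binary_matroid :: "'e pre_matroid \<Rightarrow> bool" where
  "binary_matroid M \<longleftrightarrow> matroid M \<and> (\<exists>A. represents A M)"

definition split_matrix :: "'e gf2_matrix \<Rightarrow> 'e \<Rightarrow> 'e \<Rightarrow> 'e gf2_matrix" where
  "split_matrix A x y = A @ [\<lambda>e. if e = x \<or> e = y then 1 else 0]"

text \<open>
  The choice of the representing matrix is immaterial, see
  \<open>splitting_matroid_eq\<close> below.
\<close>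

definition splitting_matroid :: "'e pre_matroid \<Rightarrow> 'e \<Rightarrow> 'e \<Rightarrow> 'e pre_matroid" where
  "splitting_matroid M x y =
     vector_matroid (ground M) (split_matrix (SOME A. represents A M) x y)"


section \<open>Independence of the representing matrix\<close>

lemma ground_vector_matroid [simp]: "ground (vector_matroid E A) = E"
  by (simp add: vector_matroid_def)

lemma bit_fun_add_self: "(v :: nat \<Rightarrow> bit) + v = 0"
  by (rule ext) (simp add: plus_fun_def zero_fun_def)

lemma indep_vector_matroid_iff:
  assumes "finite E"
  shows "indep (vector_matroid E A) X \<longleftrightarrow>
           X \<subseteq> E \<and> (\<forall>D \<subseteq> X. D \<noteq> {} \<longrightarrow> sum (column A) D \<noteq> 0)"
proof (cases "X \<subseteq> E")
  case XE: True
  then have finX: "finite X" using assms finite_subset by blast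
  have "(inj_on (column A) X \<and> gf2.independent (column A ` X)) \<longleftrightarrow>
          (\<forall>D \<subseteq> X. D \<noteq> {} \<longrightarrow> sum (column A) D \<noteq> 0)" (is "?L \<longleftrightarrow> ?R")
  proof
    assume L: ?L
    show ?R
    proof (intro allI impI notI)
      fix D assume D: "D \<subseteq> X" "D \<noteq> {}" "sum (column A) D = 0"
      have "inj_on (column A) D" using L D(1) inj_on_subset by blast
      then have "sum (\<lambda>v. v) (column A ` D) = 0"
        using D(3) by (simp add: sum.reindex)
      then have "(\<Sum>v\<in>column A ` D. (\<lambda>i. (1::bit) * v i)) = 0" by (simp only: mult_1_left)
      moreover have "finite (column A ` D)" "column A ` D \<subseteq> column A ` X"
        using D(1) finX finite_subset by blast+
      moreover obtain d where "d \<in> D" using D(2) by blast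
      ultimately have "(1::bit) = 0"
        using L gf2.independentD[of "column A ` X" "column A ` D" "\<lambda>_. 1" "column A d"] by blast
      then show False by simp
    qed
  next
    assume R: ?R
    have inj: "inj_on (column A) X"
    proof (rule inj_onI, rule ccontr)
      fix e f assume ef: "e \<in> X" "f \<in> X" "column A e = column A f" "e \<noteq> f"
      then have "sum (column A) {e, f} = 0" by (simp add: bit_fun_add_self)
      with R ef show False by (metis empty_subsetI insert_not_empty insert_subset)
    qed
    moreover have "gf2.independent (column A ` X)"
    proof (rule ccontr)
      assume "\<not> gf2.independent (column A ` X)"
      then obtain u v where u: "v \<in> column A ` X" "u v \<noteq> 0"
        "(\<Sum>v\<in>column A ` X. (\<lambda>i. u v * v i)) = 0"
        using gf2.dependent_finite[of "column A ` X"] finX by auto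
      define D where "D = {e \<in> X. u (column A e) \<noteq> 0}"
      have "sum (column A) D = (\<Sum>e\<in>X. (\<lambda>i. u (column A e) * column A e i))"
        unfolding D_def using finX
        by (subst sum.inter_filter) (auto simp: zero_fun_def intro!: sum.cong)
      also have "\<dots> = 0" using u(3) inj by (simp add: sum.reindex)
      finally have "sum (column A) D = 0" .
      moreover have "D \<subseteq> X" "D \<noteq> {}" using u by (auto simp: D_def)
      ultimately show False using R by blast
    qed
    ultimately show ?L by blast
  qed
  then show ?thesis using XE by (simp add: vector_matroid_def)
qed (simp add: vector_matroid_def)

lemma column_sum_determined:
  assumes fin: "finite E" and eq: "vector_matroid E A = vector_matroid E B"
    and "D \<subseteq> E" "sum (column A) D = 0"
  shows "sum (column B) D = 0"
  using assms(3,4)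
proof (induction "card D" arbitrary: D rule: less_induct)
  case less
  have finD: "finite D" using less.prems(1) fin finite_subset by blast
  show ?case
  proof (cases "D = {}")
    case False
    let ?dep = "\<lambda>C. C \<subseteq> D \<and> C \<noteq> {} \<and> \<not> indep (vector_matroid E A) C"
    have "?dep D" using False less.prems indep_vector_matroid_iff[OF fin, of A D] by auto
    then obtain C where C: "?dep C" and min: "\<And>C'. ?dep C' \<Longrightarrow> card C \<le> card C'"
      using ex_has_least_nat[of ?dep D card] by blast
    have CE: "C \<subseteq> E" using C less.prems(1) by blast
    have finC: "finite C" using C finD finite_subset by blast
    have zero: "sum (column F) C = 0" if F: "vector_matroid E F = vector_matroid E A" for F
    proof -
      obtain C' where C': "C' \<subseteq> C" "C' \<noteq> {}" "sum (column F) C' = 0"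
        using C CE indep_vector_matroid_iff[OF fin, of F C] F by auto
      then have "\<not> indep (vector_matroid E F) C'"
        using indep_vector_matroid_iff[OF fin, of F C'] by auto
      then have "card C \<le> card C'" using min C C' F by auto
      then have "C' = C" using C' finC card_seteq by blast
      then show ?thesis using C' by simp
    qed
    have split: "sum (column F) D = sum (column F) (D - C) + sum (column F) C" for F
      using C finD by (simp add: sum.subset_diff)
    have "card (D - C) < card D"
      using C by (intro psubset_card_mono finD) blast
    moreover have "sum (column A) (D - C) = 0"
      using split[of A] zero[of A] less.prems(2) by simp
    ultimately have "sum (column B) (D - C) = 0"
      using less.hyps less.prems(1) by blast
    then show ?thesis using split[of B] zero[of B] eq by simp
  qed simp
qed

lemma column_split_matrix:
  "column (split_matrix A x y) e i =
     (if i < length A then column A e i else if i = length A \<and> (e = x \<or> e = y) then 1 else 0)"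
  by (auto simp: column_def split_matrix_def nth_append)

lemma sum_fun_apply: "sum g D i = (\<Sum>e\<in>D. g e i)"
  for g :: "'e \<Rightarrow> nat \<Rightarrow> bit"
  by (induction D rule: infinite_finite_induct) auto

lemma sum_column_split_matrix:
  "sum (column (split_matrix A x y)) D = 0 \<longleftrightarrow>
     sum (column A) D = 0 \<and> (\<Sum>e\<in>D. if e = x \<or> e = y then 1 else 0 :: bit) = 0"
proof -
  let ?n = "length A" and ?S = "sum (column (split_matrix A x y)) D"
  let ?t = "\<Sum>e\<in>D. if e = x \<or> e = y then 1 else 0 :: bit"
  have lt: "?S i = sum (column A) D i" if "i < ?n" for i
    using that by (simp add: sum_fun_apply column_split_matrix)
  have at: "?S ?n = ?t"
    by (simp add: sum_fun_apply column_split_matrix)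
  have gt: "?S i = 0" if "?n < i" for i
    using that by (simp add: sum_fun_apply column_split_matrix)
  have ge: "sum (column A) D i = 0" if "?n \<le> i" for i
    using that by (simp add: sum_fun_apply column_def)
  show ?thesis
  proof
    assume S: "?S = 0"
    have "sum (column A) D i = 0" for i
      using lt[of i] ge[of i] S by (cases "i < ?n") simp_all
    moreover have "?t = 0" using at S by simp
    ultimately show "sum (column A) D = 0 \<and> ?t = 0" by (simp add: fun_eq_iff)
  next
    assume R: "sum (column A) D = 0 \<and> ?t = 0"
    have "?S i = 0" for i
      using lt[of i] at gt[of i] R by (cases i ?n rule: linorder_cases) simp_all
    then show "?S = 0" by (simp add: fun_eq_iff)
  qed
qed

theorem splitting_matroid_eq:
  assumes "finite (ground M)" and "represents A M"
  shows "splitting_matroid M x y = vector_matroid (ground M) (split_matrix A x y)"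
proof -
  define B where "B = (SOME A. represents A M)"
  have "represents B M" unfolding B_def using assms(2) by (rule someI)
  then have AB: "vector_matroid (ground M) A = vector_matroid (ground M) B"
    using assms(2) by (simp add: represents_def)
  have "sum (column A) D = 0 \<longleftrightarrow> sum (column B) D = 0" if "D \<subseteq> ground M" for D
    using column_sum_determined[OF assms(1) AB that]
      column_sum_determined[OF assms(1) AB[symmetric] that] by blast
  then have "indep (vector_matroid (ground M) (split_matrix B x y)) X =
        indep (vector_matroid (ground M) (split_matrix A x y)) X" for X
    unfolding indep_vector_matroid_iff[OF assms(1)] sum_column_split_matrix
    by (meson order_trans)
  then have "vector_matroid (ground M) (split_matrix B x y) =
        vector_matroid (ground M) (split_matrix A x y)"
    by (intro pre_matroid.equality) (auto simp: fun_eq_iff)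
  then show ?thesis by (simp add: splitting_matroid_def B_def)
qed

lemma matroid_vector_matroid:
  assumes "finite E"
  shows "matroid (vector_matroid E A)"
proof -
  have "\<exists>e \<in> Y - X. indep (vector_matroid E A) (insert e X)"
    if X: "indep (vector_matroid E A) X" and Y: "indep (vector_matroid E A) Y"
      and lt: "card X < card Y" for X Y
  proof (rule ccontr)
    assume neg: "\<not> ?thesis"
    have iX: "X \<subseteq> E" "inj_on (column A) X" "gf2.independent (column A ` X)"
      and iY: "Y \<subseteq> E" "inj_on (column A) Y" "gf2.independent (column A ` Y)"
      using X Y by (auto simp: vector_matroid_def)
    have "column A e \<in> gf2.span (column A ` X)" if "e \<in> Y" for e
    proof (rule ccontr)
      assume n: "column A e \<notin> gf2.span (column A ` X)"
      then have "column A e \<notin> column A ` X" using gf2.span_base by blast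
      then have "indep (vector_matroid E A) (insert e X)"
        using iX iY that n gf2.independent_insertI[OF n]
        by (auto simp: vector_matroid_def)
      moreover have "e \<notin> X" using \<open>column A e \<notin> column A ` X\<close> by blast
      ultimately show False using neg that by blast
    qed
    then have "column A ` Y \<subseteq> gf2.span (column A ` X)" by blast
    moreover have "finite (column A ` X)" using iX assms finite_subset by blast
    ultimately have "card (column A ` Y) \<le> card (column A ` X)"
      using gf2.independent_span_bound iY(3) by blast
    then show False using lt iX iY by (simp add: card_image)
  qed
  moreover have "indep (vector_matroid E A) Y"
    if "indep (vector_matroid E A) X" "Y \<subseteq> X" for X Y
    using that by (auto simp add: indep_vector_matroid_iff[OF assms])
  moreover have "indep (vector_matroid E A) {}"
    by (simp add: indep_vector_matroid_iff[OF assms])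
  moreover have "X \<subseteq> E" if "indep (vector_matroid E A) X" for X
    using that by (simp add: indep_vector_matroid_iff[OF assms])
  ultimately show ?thesis
    using assms unfolding matroid_def ground_vector_matroid by blast
qed

end

theory Submission
  imports Defs
begin

text \<open>
  Over GF(2) a set of columns is determined by its indicator vector, so a matrix \<open>A\<close> over a
  finite ground set gives the family \<open>Z\<close> of all sets of columns with sum zero. It contains the
  empty set and is closed under symmetric difference, and the circuits of the matroid are its
  minimal nonempty members. Adjoining the splitting row passes from \<open>Z\<close> to the subfamily \<open>Z'\<close>
  of the members that contain both or neither of \<open>x\<close> and \<open>y\<close>. The theorem is a statement
  about these two families, and rests on two facts about such families: lying in a common
  circuit is a transitive relation (\<open>linked_trans\<close>), and intersecting with a connected
  component preserves membership (\<open>Int_separator\<close>).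

  Let the splitting be connected, and suppose some component \<open>K\<close> of \<open>M\<close> avoids \<open>x\<close> and \<open>y\<close>.
  As \<open>M\<close> is disconnected, some circuit \<open>C\<close> of the splitting meets \<open>K\<close> and also its complement.
  But \<open>C \<inter> K\<close> belongs to \<open>Z\<close> and, missing \<open>x\<close> and \<open>y\<close>, to \<open>Z'\<close>, which contradicts the minimality
  of \<open>C\<close>. So every component contains \<open>x\<close> or \<open>y\<close>, and as there are at least two
  components there are exactly two, separating \<open>x\<close> from \<open>y\<close>.

  Conversely let \<open>S \<ni> x\<close> and \<open>T \<ni> y\<close> be the only components. For \<open>e \<in> S\<close> and \<open>f \<in> T\<close> choose
  circuits \<open>C\<^sub>1\<close> of \<open>M\<close> through \<open>e\<close> and \<open>x\<close>, and \<open>C\<^sub>2\<close> through \<open>f\<close> and \<open>y\<close>. A member of \<open>Z\<close> inside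
  \<open>C\<^sub>1 \<union> C\<^sub>2\<close> is a union of some of \<open>C\<^sub>1\<close>, \<open>C\<^sub>2\<close>, and the condition at \<open>x\<close> and \<open>y\<close> admits
  only both or none, so \<open>C\<^sub>1 \<union> C\<^sub>2\<close> is a circuit of the splitting through \<open>e\<close> and \<open>f\<close>. Two
  elements of the same component are then linked through \<open>x\<close> or \<open>y\<close> in the other one.
\<close>

section \<open>Families of sets closed under symmetric difference\<close>

definition min_member :: "'e set set \<Rightarrow> 'e set \<Rightarrow> bool" where
  "min_member Z C \<longleftrightarrow> C \<in> Z \<and> C \<noteq> {} \<and> (\<forall>D \<in> Z. D \<subseteq> C \<longrightarrow> D \<noteq> {} \<longrightarrow> D = C)"

definition linked :: "'e set set \<Rightarrow> 'e \<Rightarrow> 'e \<Rightarrow> bool" where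
  "linked Z e f \<longleftrightarrow> (\<exists>C. min_member Z C \<and> e \<in> C \<and> f \<in> C)"

lemma min_member_in: "min_member Z C \<Longrightarrow> C \<in> Z"
  unfolding min_member_def by simp

lemma min_member_minimal:
  "min_member Z C \<Longrightarrow> D \<in> Z \<Longrightarrow> D \<subseteq> C \<Longrightarrow> D \<noteq> {} \<Longrightarrow> D = C"
  unfolding min_member_def by simp

lemma linked_sym: "linked Z e f \<Longrightarrow> linked Z f e"
  unfolding linked_def by blast

definition link_rel :: "'e set \<Rightarrow> 'e set set \<Rightarrow> ('e \<times> 'e) set" where
  "link_rel E Z = {(e, f). e \<in> E \<and> f \<in> E \<and> (e = f \<or> linked Z e f)}"

locale cycle_space =
  fixes E :: "'e set" and Z :: "'e set set"
  assumes finite_ground: "finite E"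
    and members_subset: "D \<in> Z \<Longrightarrow> D \<subseteq> E"
    and empty_member: "{} \<in> Z"
    and sym_diff_member: "D \<in> Z \<Longrightarrow> D' \<in> Z \<Longrightarrow> sym_diff D D' \<in> Z"
begin

lemma Diff_member:
  assumes "D \<in> Z" "D' \<in> Z" "D' \<subseteq> D"
  shows "D - D' \<in> Z"
proof -
  have "sym_diff D D' = D - D'" using assms(3) by blast
  then show ?thesis using sym_diff_member[OF assms(1,2)] by simp
qed

lemma finite_member: "D \<in> Z \<Longrightarrow> finite D"
  using members_subset finite_ground finite_subset by blast

text \<open>
  A smallest member inside \<open>D\<close> that contains \<open>e\<close> is a minimal member: if \<open>D'\<close> is a proper nonempty
  member below it, one of \<open>D'\<close> and its complement is a smaller member containing \<open>e\<close>.
\<close>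

lemma min_member_through:
  assumes "D \<in> Z" "e \<in> D"
  obtains C where "min_member Z C" "e \<in> C" "C \<subseteq> D"
proof -
  let ?P = "\<lambda>C. C \<in> Z \<and> e \<in> C \<and> C \<subseteq> D"
  obtain C where C: "?P C" and least: "\<And>C'. ?P C' \<Longrightarrow> card C \<le> card C'"
    using ex_has_least_nat[of ?P D card] assms by blast
  have no_smaller: "C' = C" if "?P C'" "C' \<subseteq> C" for C'
    using least[OF that(1)] that(2) C finite_member card_seteq by blast
  have "D' = C" if D': "D' \<in> Z" "D' \<subseteq> C" "D' \<noteq> {}" for D'
  proof (cases "e \<in> D'")
    case True
    then show ?thesis using no_smaller[of D'] D' C by blast
  next
    case False
    then have "C - D' = C"
      using no_smaller[of "C - D'"] Diff_member[of C D'] D' C by blast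
    then show ?thesis using D' by blast
  qed
  then have "min_member Z C" using C unfolding min_member_def by blast
  then show ?thesis using that C by blast
qed

text \<open>
  Keep \<open>C\<^sub>2\<close> (through \<open>f\<close> and \<open>g\<close>) fixed and choose \<open>C\<^sub>1\<close> through \<open>e\<close>, meeting \<open>C\<^sub>2\<close>, with as
  few elements outside \<open>C\<^sub>2\<close> as possible. Suppose that neither of them contains both \<open>e\<close> and \<open>g\<close>.
  A minimal member \<open>D\<close> through \<open>e\<close> inside the symmetric difference of \<open>C\<^sub>1\<close> and \<open>C\<^sub>2\<close> meets \<open>C\<^sub>2\<close>,
  since otherwise it would be a proper part of \<open>C\<^sub>1\<close>. By the choice of \<open>C\<^sub>1\<close> it then contains all
  of \<open>C\<^sub>1 - C\<^sub>2\<close>. What it leaves over of the symmetric difference is therefore a member properly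
  inside \<open>C\<^sub>2\<close>, so it is empty and \<open>D\<close> contains \<open>g\<close>.
\<close>

lemma linked_trans:
  assumes "linked Z e f" "linked Z f g"
  shows "linked Z e g"
proof -
  obtain C2 where C2: "min_member Z C2" "f \<in> C2" "g \<in> C2"
    using assms(2) unfolding linked_def by blast
  let ?P = "\<lambda>C. min_member Z C \<and> e \<in> C \<and> C \<inter> C2 \<noteq> {}"
  have "\<exists>C. ?P C" using assms(1) C2(2) unfolding linked_def by blast
  then obtain C1 where C1: "?P C1"
    and least: "\<And>C. ?P C \<Longrightarrow> card (C1 - C2) \<le> card (C - C2)"
    using ex_has_least_nat[of ?P _ "\<lambda>C. card (C - C2)"] by blast
  show ?thesis
  proof (cases "e \<in> C2 \<or> g \<in> C1")
    case True
    then show ?thesis using C1 C2 unfolding linked_def by blast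
  next
    case False
    let ?S = "sym_diff C1 C2"
    have S: "?S \<in> Z" using sym_diff_member min_member_in C1 C2(1) by metis
    have "e \<in> ?S" using C1 False by blast
    then obtain D where D: "min_member Z D" "e \<in> D" "D \<subseteq> ?S"
      using min_member_through[OF S] by blast
    have "D \<inter> C2 \<noteq> {}"
    proof
      assume "D \<inter> C2 = {}"
      then have "D \<subseteq> C1" using D(3) by blast
      then have "D = C1" using min_member_minimal[of Z C1 D] min_member_in[OF D(1)] C1 D(2) by blast
      then show False using C1 D(3) by blast
    qed
    then have "card (C1 - C2) \<le> card (D - C2)" using least D by blast
    moreover have "D - C2 \<subseteq> C1 - C2" using D(3) by blast
    moreover have "finite (C1 - C2)" using C1 finite_member min_member_in by blast
    ultimately have "D - C2 = C1 - C2" using card_seteq by blast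
    then have sub: "?S - D \<subseteq> C2 - C1" by blast
    have "?S - D \<in> Z" using Diff_member[OF S min_member_in[OF D(1)] D(3)] .
    then have "?S - D = {} \<or> ?S - D = C2" using min_member_minimal[OF C2(1)] sub by blast
    moreover have "?S - D \<noteq> C2" using sub C1 by blast
    ultimately have "g \<in> D" using C2(3) False by blast
    then show ?thesis using D unfolding linked_def by blast
  qed
qed

lemma equiv_link_rel: "equiv E (link_rel E Z)"
proof (rule equivI)
  show "link_rel E Z \<subseteq> E \<times> E" "refl_on E (link_rel E Z)"
    unfolding link_rel_def refl_on_def by auto
  show "sym (link_rel E Z)"
    unfolding link_rel_def sym_def by (auto intro: linked_sym)
  show "trans (link_rel E Z)"
    unfolding link_rel_def trans_def using linked_trans by blast
qed

text \<open>
  Each member is a disjoint union of minimal members, each of which lies inside or outside \<open>K\<close>.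
\<close>

lemma Int_separator:
  assumes sep: "\<And>C. min_member Z C \<Longrightarrow> C \<subseteq> K \<or> C \<inter> K = {}"
    and "D \<in> Z"
  shows "D \<inter> K \<in> Z"
  using assms(2)
proof (induction "card D" arbitrary: D rule: less_induct)
  case less
  show ?case
  proof (cases "D = {}")
    case False
    then obtain C where C: "min_member Z C" "C \<subseteq> D"
      using min_member_through[OF less.prems] by blast
    have CZ: "C \<in> Z" "C \<noteq> {}" using C unfolding min_member_def by auto
    have "card (D - C) < card D"
      using CZ C(2) finite_member[OF less.prems] by (intro psubset_card_mono) auto
    then have IH: "(D - C) \<inter> K \<in> Z" using less Diff_member CZ C(2) by blast
    have "C \<inter> K \<in> Z"
    proof (cases "C \<subseteq> K")
      case True
      then show ?thesis using CZ by (simp add: Int_absorb2)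
    next
      case False
      then show ?thesis using sep[OF C(1)] empty_member by auto
    qed
    moreover have "D \<inter> K = sym_diff ((D - C) \<inter> K) (C \<inter> K)" using C(2) by blast
    ultimately show ?thesis using sym_diff_member[OF IH] by simp
  qed (simp add: empty_member)
qed

lemma class_separates:
  assumes K: "K \<in> E // link_rel E Z" and C: "min_member Z C"
  shows "C \<subseteq> K \<or> C \<inter> K = {}"
proof (cases "C \<inter> K = {}")
  case False
  then obtain e where e: "e \<in> C" "e \<in> K" by blast
  have "C \<subseteq> E" using C members_subset unfolding min_member_def by blast
  then have "(e, f) \<in> link_rel E Z" if "f \<in> C" for f
    using C that e(1) unfolding link_rel_def linked_def by blast
  then show ?thesis using in_quotient_imp_closed[OF equiv_link_rel K e(2)] by blast
qed simp

lemma linked_in_class: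
  assumes "K \<in> E // link_rel E Z" "e \<in> K" "f \<in> K" "e \<noteq> f"
  shows "linked Z e f"
  using quotient_eq_iff[OF equiv_link_rel assms(1,1,2,3)] assms(4)
  unfolding link_rel_def by blast

section \<open>Splitting a cycle space\<close>

lemma cycle_space_split: "cycle_space E {D \<in> Z. x \<in> D \<longleftrightarrow> y \<in> D}"
  using finite_ground members_subset empty_member sym_diff_member by unfold_locales auto

lemma class_meets_split_pair:
  assumes conn: "\<And>e f. e \<in> E \<Longrightarrow> f \<in> E \<Longrightarrow> e \<noteq> f \<Longrightarrow> linked {D \<in> Z. x \<in> D \<longleftrightarrow> y \<in> D} e f"
    and K: "K \<in> E // link_rel E Z" and "K \<noteq> E"
  shows "x \<in> K \<or> y \<in> K"
proof (rule ccontr)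
  assume avoid: "\<not> (x \<in> K \<or> y \<in> K)"
  have "K \<subseteq> E" using in_quotient_imp_subset[OF equiv_link_rel K] .
  moreover have "K \<noteq> {}" using in_quotient_imp_non_empty[OF equiv_link_rel K] .
  ultimately obtain e f where ef: "e \<in> K" "e \<in> E" "f \<in> E" "f \<notin> K" using \<open>K \<noteq> E\<close> by blast
  then obtain C where C: "min_member {D \<in> Z. x \<in> D \<longleftrightarrow> y \<in> D} C" "e \<in> C" "f \<in> C"
    using conn[of e f] unfolding linked_def by blast
  have "C \<in> Z" using min_member_in[OF C(1)] by simp
  then have "C \<inter> K \<in> Z" using Int_separator[OF class_separates[OF K]] by simp
  then have "C \<inter> K = C" using min_member_minimal[OF C(1)] avoid C(2) ef(1) by blast
  then show False using C(3) ef(4) by blast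
qed

lemma split_connected_imp_two_classes:
  assumes conn: "\<And>e f. e \<in> E \<Longrightarrow> f \<in> E \<Longrightarrow> e \<noteq> f \<Longrightarrow> linked {D \<in> Z. x \<in> D \<longleftrightarrow> y \<in> D} e f"
    and disconn: "\<not> (\<forall>e \<in> E. \<forall>f \<in> E. e \<noteq> f \<longrightarrow> linked Z e f)"
    and x: "x \<in> E" and y: "y \<in> E"
  shows "\<exists>S T. S \<noteq> T \<and> E // link_rel E Z = {S, T} \<and> x \<in> S \<and> y \<in> T"
proof -
  let ?R = "link_rel E Z"
  let ?S = "?R `` {x}" and ?T = "?R `` {y}"
  have S: "?S \<in> E // ?R" "x \<in> ?S" and T: "?T \<in> E // ?R" "y \<in> ?T"
    using quotientI[of _ E ?R] equiv_class_self[OF equiv_link_rel] x y by simp_all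
  have proper: "K \<noteq> E" if "K \<in> E // ?R" for K
    using disconn linked_in_class[OF that] by blast
  have "K = ?S \<or> K = ?T" if K: "K \<in> E // ?R" for K
    using class_meets_split_pair[OF conn K proper[OF K]]
      quotient_disj[OF equiv_link_rel K S(1)] quotient_disj[OF equiv_link_rel K T(1)] S(2) T(2)
    by blast
  then have all: "E // ?R = {?S, ?T}" using S T by blast
  have "?S \<noteq> ?T"
  proof
    assume "?S = ?T"
    then have "?S = E" using all Union_quotient[OF equiv_link_rel] by auto
    then show False using proper S(1) by blast
  qed
  then show ?thesis using all S(2) T(2) by (intro exI conjI)
qed

lemma two_classes_imp_split_connected:
  assumes classes: "E // link_rel E Z = {S, T}" and "S \<noteq> T" and x: "x \<in> S" and y: "y \<in> T"
    and xx: "linked Z x x" and yy: "linked Z y y"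
    and e: "e \<in> E" and f: "f \<in> E"
  shows "linked {D \<in> Z. x \<in> D \<longleftrightarrow> y \<in> D} e f"
proof -
  let ?Z' = "{D \<in> Z. x \<in> D \<longleftrightarrow> y \<in> D}"
  interpret split: cycle_space E ?Z' by (rule cycle_space_split)
  have S: "S \<in> E // link_rel E Z" and T: "T \<in> E // link_rel E Z" using classes by auto
  have disj: "S \<inter> T = {}" using quotient_disj[OF equiv_link_rel S T] \<open>S \<noteq> T\<close> by blast
  have un: "E = S \<union> T" using Union_quotient[OF equiv_link_rel] classes by auto
  have across: "linked ?Z' a b" if a: "a \<in> S" and b: "b \<in> T" for a b
  proof -
    have "linked Z a x" using linked_in_class[OF S a x] xx by blast
    then obtain C1 where C1: "min_member Z C1" "a \<in> C1" "x \<in> C1" unfolding linked_def by blast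
    have "linked Z b y" using linked_in_class[OF T b y] yy by blast
    then obtain C2 where C2: "min_member Z C2" "b \<in> C2" "y \<in> C2" unfolding linked_def by blast
    have C1S: "C1 \<subseteq> S" using class_separates[OF S C1(1)] C1(3) x by blast
    have C2T: "C2 \<subseteq> T" using class_separates[OF T C2(1)] C2(3) y by blast
    have "sym_diff C1 C2 \<in> Z"
      using sym_diff_member[OF min_member_in[OF C1(1)] min_member_in[OF C2(1)]] .
    moreover have "sym_diff C1 C2 = C1 \<union> C2" using C1S C2T disj by blast
    ultimately have "C1 \<union> C2 \<in> ?Z'" using C1(3) C2(3) by auto
    moreover have "D = C1 \<union> C2" if D: "D \<in> ?Z'" "D \<subseteq> C1 \<union> C2" "D \<noteq> {}" for D
    proof -
      have "D \<in> Z" using D(1) by simp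
      then have "D \<inter> S \<in> Z" "D \<inter> T \<in> Z"
        using Int_separator[OF class_separates[OF S]] Int_separator[OF class_separates[OF T]]
        by simp_all
      moreover have "D \<inter> S \<subseteq> C1" "D \<inter> T \<subseteq> C2" using D(2) C1S C2T disj by blast+
      ultimately have "D \<inter> S = {} \<or> D \<inter> S = C1" "D \<inter> T = {} \<or> D \<inter> T = C2"
        using min_member_minimal[OF C1(1)] min_member_minimal[OF C2(1)] by blast+
      moreover have "D = (D \<inter> S) \<union> (D \<inter> T)" using D(2) C1S C2T by blast
      moreover have "x \<in> D \<longleftrightarrow> y \<in> D" using D(1) by simp
      ultimately show ?thesis using D(3) C1(3) C2(3) x y by blast
    qed
    ultimately have "min_member ?Z' (C1 \<union> C2)" using C1(2) unfolding min_member_def by blast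
    then show ?thesis using C1(2) C2(2) unfolding linked_def by blast
  qed
  consider "e \<in> S" "f \<in> S" | "e \<in> S" "f \<in> T" | "e \<in> T" "f \<in> S" | "e \<in> T" "f \<in> T"
    using e f un by blast
  then show ?thesis
  proof cases
    case 1
    show ?thesis
      using split.linked_trans[OF across[OF 1(1) y] linked_sym[OF across[OF 1(2) y]]] .
  next
    case 2
    show ?thesis using across[OF 2] .
  next
    case 3
    show ?thesis using linked_sym[OF across[OF 3(2,1)]] .
  next
    case 4
    show ?thesis
      using split.linked_trans[OF linked_sym[OF across[OF x 4(1)]] across[OF x 4(2)]] .
  qed
qed

end

section \<open>The cycle space of a matrix\<close>

definition cycles :: "'e set \<Rightarrow> 'e gf2_matrix \<Rightarrow> 'e set set" where
  "cycles E A = {D. D \<subseteq> E \<and> sum (column A) D = 0}"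

lemma cycle_space_cycles:
  assumes "finite E"
  shows "cycle_space E (cycles E A)"
proof
  fix D D' assume D: "D \<in> cycles E A" and D': "D' \<in> cycles E A"
  then have fin: "finite D" "finite D'" using assms finite_subset unfolding cycles_def by blast+
  let ?s = "sum (column A)"
  have "?s (sym_diff D D') = ?s (D - D') + ?s (D' - D)"
    using fin by (intro sum.union_disjoint) auto
  \<comment> \<open>In characteristic 2 the common part may be added twice.\<close>
  also have "\<dots> = (?s (D - D') + ?s (D \<inter> D')) + (?s (D' - D) + ?s (D \<inter> D'))"
    using bit_fun_add_self[of "?s (D \<inter> D')"] by (simp add: add.assoc add.left_commute)
  also have "?s (D - D') + ?s (D \<inter> D') = ?s D"
    using sum.Int_Diff[OF fin(1), of "column A" D'] by (simp add: add.commute)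
  also have "?s (D' - D) + ?s (D \<inter> D') = ?s D'"
    using sum.Int_Diff[OF fin(2), of "column A" D] by (simp add: add.commute Int_commute)
  finally show "sym_diff D D' \<in> cycles E A" using D D' unfolding cycles_def by auto
qed (use assms in \<open>auto simp: cycles_def\<close>)

lemma indep_iff_no_cycle:
  assumes "finite E"
  shows "indep (vector_matroid E A) X \<longleftrightarrow> X \<subseteq> E \<and> (\<forall>D \<in> cycles E A. D \<subseteq> X \<longrightarrow> D = {})"
  unfolding indep_vector_matroid_iff[OF assms] cycles_def by blast

lemma circuit_iff_min_member:
  assumes "finite E"
  shows "circuit (vector_matroid E A) C \<longleftrightarrow> min_member (cycles E A) C"
proof
  assume C: "circuit (vector_matroid E A) C"
  then have "C \<subseteq> E" "\<not> indep (vector_matroid E A) C"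
    and proper: "\<And>X. X \<subset> C \<Longrightarrow> indep (vector_matroid E A) X"
    unfolding circuit_def by auto
  then obtain D where D: "D \<in> cycles E A" "D \<subseteq> C" "D \<noteq> {}"
    using indep_iff_no_cycle[OF assms, of A C] by auto
  have eq: "D' = C" if "D' \<in> cycles E A" "D' \<subseteq> C" "D' \<noteq> {}" for D'
    using proper[of D'] that indep_iff_no_cycle[OF assms, of A D'] by auto
  have "D = C" using eq[OF D] .
  then show "min_member (cycles E A) C" using D eq unfolding min_member_def by blast
next
  assume C: "min_member (cycles E A) C"
  then have CE: "C \<subseteq> E" unfolding min_member_def cycles_def by blast
  have "\<not> indep (vector_matroid E A) C"
    using C unfolding indep_iff_no_cycle[OF assms] min_member_def by blast
  moreover have "indep (vector_matroid E A) X" if "X \<subset> C" for X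
    unfolding indep_iff_no_cycle[OF assms]
    using min_member_minimal[OF C] CE that by blast
  ultimately show "circuit (vector_matroid E A) C" using CE unfolding circuit_def by simp
qed

lemma matroid_connected_iff_linked:
  assumes "finite E"
  shows "matroid_connected (vector_matroid E A) \<longleftrightarrow>
           (\<forall>e \<in> E. \<forall>f \<in> E. e \<noteq> f \<longrightarrow> linked (cycles E A) e f)"
  unfolding matroid_connected_def linked_def circuit_iff_min_member[OF assms] by simp

lemma components_eq_quotient:
  assumes "finite E"
  shows "components (vector_matroid E A) = E // link_rel E (cycles E A)"
  unfolding components_def component_rel_def link_rel_def linked_def
    circuit_iff_min_member[OF assms] by simp

lemma cycles_split_matrix:
  assumes "finite E" "x \<noteq> y"
  shows "cycles E (split_matrix A x y) = {D \<in> cycles E A. x \<in> D \<longleftrightarrow> y \<in> D}"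
proof -
  have "(\<Sum>e\<in>D. if e = x \<or> e = y then 1 else 0 :: bit) = 0 \<longleftrightarrow> (x \<in> D \<longleftrightarrow> y \<in> D)"
    if "D \<subseteq> E" for D
  proof -
    have fin: "finite D" using that assms(1) finite_subset by blast
    have "(\<Sum>e\<in>D. if e = x \<or> e = y then 1 else 0 :: bit) =
          (\<Sum>e\<in>D. (if e = x then 1 else 0) + (if e = y then 1 else 0))"
      using assms(2) by (intro sum.cong refl) auto
    also have "\<dots> = (if x \<in> D then 1 else 0) + (if y \<in> D then 1 else 0)"
      unfolding sum.distrib using fin by simp
    finally show ?thesis by (simp split: if_splits)
  qed
  then show ?thesis unfolding cycles_def sum_column_split_matrix by blast
qed

lemma matroid_basis_exists:
  assumes "matroid M"
  obtains B where "basis M B"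
proof -
  have fin: "finite (ground M)" and sub: "\<And>X. indep M X \<Longrightarrow> X \<subseteq> ground M"
    and "indep M {}"
    using assms unfolding matroid_def by simp_all
  have "{X. indep M X} \<subseteq> Pow (ground M)" using sub by blast
  then have "finite {X. indep M X}" by (rule finite_subset) (simp add: fin)
  moreover have "{X. indep M X} \<noteq> {}" using \<open>indep M {}\<close> by blast
  ultimately have "\<exists>B \<in> {X. indep M X}. \<forall>X \<in> {X. indep M X}. B \<subseteq> X \<longrightarrow> B = X"
    by (rule finite_has_maximal)
  then have "\<exists>B. basis M B" unfolding basis_def by auto
  then show ?thesis using that by blast
qed

text \<open>An element that is not a coloop is avoided by some basis, and closes a circuit with it.\<close>

lemma not_coloop_imp_linked:
  assumes "finite E" "x \<in> E" "\<not> coloop (vector_matroid E A) x"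
  shows "linked (cycles E A) x x"
proof -
  let ?M = "vector_matroid E A"
  interpret cycle_space E "cycles E A" by (rule cycle_space_cycles[OF assms(1)])
  obtain B0 where "basis ?M B0"
    using matroid_basis_exists[OF matroid_vector_matroid[OF assms(1)]] by blast
  then have "indep (dual ?M) {}" unfolding dual_def by auto
  then have "indep (dual ?M) {x}"
    using assms(2,3) unfolding coloop_def loop_def circuit_def
    by (auto simp: dual_def subset_singleton_iff)
  then obtain B where B: "basis ?M B" "x \<notin> B" unfolding dual_def by auto
  then have indB: "indep ?M B" and "\<not> indep ?M (insert x B)" unfolding basis_def by blast+
  moreover have "insert x B \<subseteq> E"
    using indB assms(2) indep_iff_no_cycle[OF assms(1), of A B] by simp
  ultimately obtain D where D: "D \<in> cycles E A" "D \<subseteq> insert x B" "D \<noteq> {}"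
    using indep_iff_no_cycle[OF assms(1), of A "insert x B"] by auto
  have "x \<in> D"
  proof (rule ccontr)
    assume "x \<notin> D"
    then have "D \<subseteq> B" using D(2) by blast
    then show False using D indB indep_iff_no_cycle[OF assms(1), of A B] by simp
  qed
  then show ?thesis using min_member_through[OF D(1)] unfolding linked_def by metis
qed

section \<open>Connectedness of the splitting matroid\<close>

theorem lemma2p1:
  fixes M :: "'e pre_matroid" and x y :: 'e
  assumes "binary_matroid M"
    and "\<not> matroid_connected M"
    and "\<forall>e \<in> ground M. \<not> loop M e"
    and "\<forall>e \<in> ground M. \<not> coloop M e"
    and "x \<in> ground M" and "y \<in> ground M" and "x \<noteq> y"
    and "\<not> cocircuit M {x, y}"
  shows "matroid_connected (splitting_matroid M x y) \<longleftrightarrow>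
         (\<exists>S T. S \<noteq> T \<and> components M = {S, T} \<and> x \<in> S \<and> y \<in> T)"
proof -
  define E where "E = ground M"
  obtain A where A: "represents A M"
    using assms(1) unfolding binary_matroid_def by (elim conjE exE)
  have fin: "finite E"
    using assms(1) unfolding binary_matroid_def matroid_def E_def by simp
  have M: "M = vector_matroid E A" using A unfolding represents_def E_def by simp
  interpret cycle_space E "cycles E A" by (rule cycle_space_cycles[OF fin])
  have split: "matroid_connected (splitting_matroid M x y) \<longleftrightarrow>
      (\<forall>e \<in> E. \<forall>f \<in> E. e \<noteq> f \<longrightarrow> linked {D \<in> cycles E A. x \<in> D \<longleftrightarrow> y \<in> D} e f)"
    using splitting_matroid_eq[OF _ A] fin
    by (simp add: E_def[symmetric] matroid_connected_iff_linked cycles_split_matrix[OF _ assms(7)])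
  have comp: "components M = E // link_rel E (cycles E A)"
    using components_eq_quotient[OF fin] M by simp
  have disconn: "\<not> (\<forall>e \<in> E. \<forall>f \<in> E. e \<noteq> f \<longrightarrow> linked (cycles E A) e f)"
    using assms(2) matroid_connected_iff_linked[OF fin] M by simp
  have xy: "x \<in> E" "y \<in> E" using assms(5,6) unfolding E_def by auto
  have xx: "linked (cycles E A) x x" and yy: "linked (cycles E A) y y"
    using not_coloop_imp_linked[OF fin xy(1), of A] not_coloop_imp_linked[OF fin xy(2), of A]
      assms(4-6) M by simp_all
  show ?thesis
    unfolding split comp
  proof
    assume "\<forall>e \<in> E. \<forall>f \<in> E. e \<noteq> f \<longrightarrow> linked {D \<in> cycles E A. x \<in> D \<longleftrightarrow> y \<in> D} e f"
    then show "\<exists>S T. S \<noteq> T \<and> E // link_rel E (cycles E A) = {S, T} \<and> x \<in> S \<and> y \<in> T"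
      by (intro split_connected_imp_two_classes[OF _ disconn xy]) blast
  next
    assume "\<exists>S T. S \<noteq> T \<and> E // link_rel E (cycles E A) = {S, T} \<and> x \<in> S \<and> y \<in> T"
    then obtain S T where "E // link_rel E (cycles E A) = {S, T}" "S \<noteq> T" "x \<in> S" "y \<in> T"
      by (elim exE conjE)
    then show "\<forall>e \<in> E. \<forall>f \<in> E. e \<noteq> f \<longrightarrow> linked {D \<in> cycles E A. x \<in> D \<longleftrightarrow> y \<in> D} e f"
      using two_classes_imp_split_connected xx yy by (intro ballI impI)
  qed
qed

end
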